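(* Let $k,n\geq 0$ be integers, and for each $i$ with $1\leq i\leq k+1$ let $p_i\geq 3$ be a prime such that $p_i\not\equiv 1\pmod 8$. Then for any integer $j\not\equiv 0\pmod{p_{k+1}}$, $$\overline{OPT}_3\bigl(8p_1^2p_2^2\cdots p_{k+1}^2\,n+p_1^2p_2^2\cdots p_k^2\,p_{k+1}(8j+p_{k+1})\bigr)\equiv 0\pmod{8}.$$
   Context: For a positive integer $m$ let $f_m:=(q^m;q^m)_\infty=\prod_{i\ge 1}(1-q^{mi})$ (as a formal power series in $q$). For a positive integer $k$ and integers $n\ge 0$, $\overline{OPT}_k(n)$ denotes the number of overpartition $k$-tuples of $n$ with all parts odd: $k$-tuples $(\xi_1,\dots,\xi_k)$ of overpartitions (partitions in which the first occurrence of each part size may be overlined) with all parts odd and total sum of all parts equal to $n$. Its generating function is $$\sum_{n\geq 0}\overline{OPT}_k(n)q^n=\frac{f_{2}^{3k}}{f_{1}^{2k}f_{4}^{k}}.$$ By convention $\overline{OPT}_k(n)=0$ for negative integers $n$. For $k=0$ the product $p_1^2\cdots p_k^2$ in the claim is the empty product $1$. *)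

theory Defs
  imports "HOL-Library.Multiset" "HOL-Number_Theory.Number_Theory"
begin

(* An overpartition is encoded as the multiset of its parts together with the set of
   those part sizes whose first occurrence is overlined. *)
type_synonym overpart = "nat multiset \<times> nat set"

definition overpartition :: "overpart \<Rightarrow> bool" where
  "overpartition \<xi> \<longleftrightarrow> 0 \<notin># fst \<xi> \<and> snd \<xi> \<subseteq> set_mset (fst \<xi>)"

definition overpart_weight :: "overpart \<Rightarrow> nat" where
  "overpart_weight \<xi> = sum_mset (fst \<xi>)"

definition all_parts_odd :: "overpart \<Rightarrow> bool" where
  "all_parts_odd \<xi> \<longleftrightarrow> (\<forall>a \<in># fst \<xi>. odd a)"

definition odd_overpart_tuples :: "nat \<Rightarrow> int \<Rightarrow> overpart list set" where
  "odd_overpart_tuples k n =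
     {\<xi>s. length \<xi>s = k \<and> (\<forall>\<xi> \<in> set \<xi>s. overpartition \<xi> \<and> all_parts_odd \<xi>) \<and>
          int (\<Sum>\<xi>\<leftarrow>\<xi>s. overpart_weight \<xi>) = n}"

(* The argument is an integer; for negative n the set of tuples is empty and the value is 0. *)
definition OPT :: "nat \<Rightarrow> int \<Rightarrow> nat" where
  "OPT k n = card (odd_overpart_tuples k n)"

lemma OPT_negative: "n < 0 \<Longrightarrow> OPT k n = 0"
  by (auto simp: OPT_def odd_overpart_tuples_def)

lemma size_le_sum_mset:
  fixes M :: "nat multiset"
  assumes "0 \<notin># M"
  shows "size M \<le> sum_mset M"
  using assms by (induction M) auto

lemma finite_overpartitions_le:
  "finite {\<xi>. overpartition \<xi> \<and> overpart_weight \<xi> \<le> n}"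
proof (rule finite_subset)
  let ?L = "{xs :: nat list. set xs \<subseteq> {..n} \<and> length xs \<le> n}"
  show "finite (mset ` ?L \<times> Pow {..n})"
    by (simp add: finite_lists_length_le)
  show "{\<xi>. overpartition \<xi> \<and> overpart_weight \<xi> \<le> n} \<subseteq> mset ` ?L \<times> Pow {..n}"
  proof safe
    fix M :: "nat multiset" and S :: "nat set"
    assume op: "overpartition (M, S)" and w: "overpart_weight (M, S) \<le> n"
    have le: "a \<le> n" if "a \<in># M" for a
      using multi_member_split[OF that] w by (auto simp: overpart_weight_def)
    have "size M \<le> n"
      using size_le_sum_mset[of M] op w by (simp add: overpartition_def overpart_weight_def)
    obtain xs where "M = mset xs"
      using ex_mset[of M] by blast
    with le \<open>size M \<le> n\<close> show "M \<in> mset ` ?L"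
      by auto
    show "a \<le> n" if "a \<in> S" for a
      using op le that by (auto simp: overpartition_def)
  qed
qed

(* Hence the card in OPT_def is a genuine count, never the default 0 of an infinite set. *)
lemma finite_odd_overpart_tuples: "finite (odd_overpart_tuples k n)"
proof (rule finite_subset)
  let ?A = "{\<xi>. overpartition \<xi> \<and> overpart_weight \<xi> \<le> nat n}"
  show "finite {\<xi>s. set \<xi>s \<subseteq> ?A \<and> length \<xi>s = k}"
    by (intro finite_lists_length_eq finite_overpartitions_le)
  show "odd_overpart_tuples k n \<subseteq> {\<xi>s. set \<xi>s \<subseteq> ?A \<and> length \<xi>s = k}"
  proof -
    have "overpart_weight \<xi> \<le> (\<Sum>\<xi>\<leftarrow>\<xi>s. overpart_weight \<xi>)" if "\<xi> \<in> set \<xi>s" for \<xi> \<xi>s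
      using that by (intro member_le_sum_list) auto
    then show ?thesis
      by (fastforce simp: odd_overpart_tuples_def)
  qed
qed

end

(* Writing the generating function of overpartitions into odd parts as 1 + 2U, its cube is
   1 + 6U + 12U^2 + 8U^3, and U^2 has even coefficients at odd exponents; so modulo 8 the number
   of triples of odd size N is three times the number of single overpartitions. The latter is a
   sum of 2^(number of part sizes), so only one or two part sizes matter. Counting solutions of
   d m + e l = N with d, e odd by involutions reduces the claim to: N has an even divisor
   count, a divisor sum divisible by 4, and evenly many representations by each of x^2 + 2y^2
   and x^2 + 4y^2 with x, y > 0. The number N of the theorem has the form p^v m with v odd, p not
   dividing m, and m congruent to p modulo 8, hence not a square. By Thue's lemma p is either
   represented by the form, and the number of representations of N is v + 1 times that of m, or p
   is inert and N is not represented at all. *)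
theory Submission
  imports Defs "HOL-Computational_Algebra.Formal_Power_Series" "HOL-Library.Discrete_Functions"
begin

section \<open>Parity of cardinalities\<close>

text \<open>The points moved by \<open>f\<close> fall into disjoint orbits \<open>{x, f x}\<close>
  of size two, so only the fixed points matter modulo 2.\<close>

lemma even_card_involution:
  assumes "finite S" and inv: "\<And>x. x \<in> S \<Longrightarrow> f x \<in> S \<and> f (f x) = x"
  shows "even (card S) \<longleftrightarrow> even (card {x \<in> S. f x = x})"
proof -
  let ?M = "{x \<in> S. f x \<noteq> x}"
  have "even (card (\<Union>((\<lambda>x. {x, f x}) ` ?M)))"
  proof (rule dvd_partition)
    show "finite (\<Union>((\<lambda>x. {x, f x}) ` ?M))"
      using \<open>finite S\<close> by auto
    show "\<forall>c\<in>(\<lambda>x. {x, f x}) ` ?M. 2 dvd card c"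
      by auto
    show "\<forall>c1\<in>(\<lambda>x. {x, f x}) ` ?M. \<forall>c2\<in>(\<lambda>x. {x, f x}) ` ?M. c1 \<noteq> c2 \<longrightarrow> c1 \<inter> c2 = {}"
    proof (intro ballI impI)
      fix c1 c2 assume "c1 \<in> (\<lambda>x. {x, f x}) ` ?M" "c2 \<in> (\<lambda>x. {x, f x}) ` ?M" "c1 \<noteq> c2"
      then obtain x y where *: "x \<in> ?M" "y \<in> ?M" "c1 = {x, f x}" "c2 = {y, f y}" "c1 \<noteq> c2"
        by auto
      with inv[of x] inv[of y] show "c1 \<inter> c2 = {}"
        by (auto simp: doubleton_eq_iff)
    qed
  qed
  moreover have "\<Union>((\<lambda>x. {x, f x}) ` ?M) = ?M"
    using inv by auto
  moreover have "card S = card ?M + card {x \<in> S. f x = x}"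
    using \<open>finite S\<close> by (subst card_Un_disjoint[symmetric]) (auto intro: arg_cong[where f = card])
  ultimately show ?thesis
    by simp
qed

section \<open>Reduction to single overpartitions\<close>

definition odd_overparts :: "nat \<Rightarrow> overpart set" where
  "odd_overparts n = {\<xi>. overpartition \<xi> \<and> all_parts_odd \<xi> \<and> overpart_weight \<xi> = n}"

lemma finite_odd_overparts: "finite (odd_overparts n)"
  by (rule finite_subset[OF _ finite_overpartitions_le[of n]]) (auto simp: odd_overparts_def)

lemma OPT_0: "OPT 0 (int n) = (if n = 0 then 1 else 0)"
proof -
  have "odd_overpart_tuples 0 (int n) = (if n = 0 then {[]} else {})"
    by (auto simp: odd_overpart_tuples_def)
  then show ?thesis
    by (simp add: OPT_def)
qed

text \<open>Sorting the tuples by the weight \<open>m\<close> of their head gives a Cauchy product,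
  which becomes a power of the generating function in \<open>OPT_gf\<close>.\<close>

lemma OPT_Suc:
  "OPT (Suc k) (int n) = (\<Sum>m\<le>n. card (odd_overparts m) * OPT k (int (n - m)))"
proof -
  let ?B = "\<lambda>m. (\<lambda>(\<xi>, \<xi>s). \<xi> # \<xi>s) ` (odd_overparts m \<times> odd_overpart_tuples k (int (n - m)))"
  have "odd_overpart_tuples (Suc k) (int n) = (\<Union>m\<le>n. ?B m)"
  proof (intro equalityI subsetI)
    fix \<xi>s assume *: "\<xi>s \<in> odd_overpart_tuples (Suc k) (int n)"
    then obtain \<xi> \<eta>s where \<xi>s: "\<xi>s = \<xi> # \<eta>s"
      by (cases \<xi>s) (auto simp: odd_overpart_tuples_def)
    have w: "overpart_weight \<xi> + (\<Sum>\<xi>\<leftarrow>\<eta>s. overpart_weight \<xi>) = n"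
      using * by (simp add: odd_overpart_tuples_def \<xi>s flip: of_nat_add)
    have "\<xi>s \<in> ?B (overpart_weight \<xi>)"
      using * w by (auto simp: odd_overpart_tuples_def odd_overparts_def \<xi>s)
    with w show "\<xi>s \<in> (\<Union>m\<le>n. ?B m)"
      by auto
  qed (auto simp: odd_overpart_tuples_def odd_overparts_def)
  moreover have "card (\<Union>m\<le>n. ?B m) = (\<Sum>m\<le>n. card (?B m))"
  proof (rule card_UN_disjoint)
    show "\<forall>m\<in>{..n}. finite (?B m)"
      by (simp add: finite_odd_overparts finite_odd_overpart_tuples)
  qed (auto simp: odd_overparts_def)
  moreover have "card (?B m) = card (odd_overparts m) * OPT k (int (n - m))" for m
    by (subst card_image) (auto simp: inj_on_def card_cartesian_product OPT_def)
  ultimately show ?thesis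
    unfolding OPT_def[of "Suc k"] by (simp only:)
qed

lemma OPT_gf:
  "Abs_fps (\<lambda>n. int (OPT k (int n))) = Abs_fps (\<lambda>n. int (card (odd_overparts n))) ^ k"
proof (induction k)
  case 0
  show ?case
    by (rule fps_ext) (simp add: OPT_0)
next
  case (Suc k)
  show ?case
    unfolding power_Suc Suc[symmetric]
    by (rule fps_ext) (simp add: OPT_Suc fps_mult_nth atMost_atLeast0)
qed

text \<open>For odd \<open>n\<close> the reflection \<open>i \<mapsto> n - i\<close> has no fixed
  point, so the terms of the convolution occur in equal pairs.\<close>

lemma even_fps_square_nth_odd:
  fixes U :: "int fps"
  assumes "odd n"
  shows "even (fps_nth (U ^ 2) n)"
proof -
  obtain h where n: "n = 2 * h + 1"
    using assms by (elim oddE)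
  have "(\<Sum>i = Suc h..n. fps_nth U i * fps_nth U (n - i)) = (\<Sum>i = 0..h. fps_nth U i * fps_nth U (n - i))"
    by (rule sum.reindex_bij_witness[where i = "\<lambda>i. n - i" and j = "\<lambda>i. n - i"])
      (auto simp: n mult.commute)
  moreover have "fps_nth (U ^ 2) n = (\<Sum>i = 0..h. fps_nth U i * fps_nth U (n - i)) + (\<Sum>i = Suc h..n. fps_nth U i * fps_nth U (n - i))"
    using sum.ub_add_nat[of 0 h "\<lambda>i. fps_nth U i * fps_nth U (n - i)" "n - h"]
    by (simp add: n power2_eq_square fps_mult_nth del: sum.cl_ivl_Suc flip: mult_2)
  ultimately show ?thesis
    by simp
qed

section \<open>Overpartitions weighted by their underlying partitions\<close>

definition odd_msets :: "nat \<Rightarrow> nat multiset set" where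
  "odd_msets n = {M. (\<forall>a\<in>#M. odd a) \<and> sum_mset M = n}"

text \<open>The overlined sizes form an arbitrary subset of the part sizes, which is the source of
  the weight \<open>2 ^ card (set_mset M)\<close>.\<close>

lemma odd_overparts_eq_Sigma: "odd_overparts n = Sigma (odd_msets n) (\<lambda>M. Pow (set_mset M))"
  by (auto simp: odd_overparts_def overpartition_def all_parts_odd_def overpart_weight_def
      odd_msets_def intro!: odd_pos)

lemma finite_odd_msets: "finite (odd_msets n)"
proof -
  have "odd_msets n = fst ` odd_overparts n"
    by (force simp: odd_overparts_eq_Sigma)
  then show ?thesis
    by (simp add: finite_odd_overparts)
qed

lemma card_odd_overparts: "card (odd_overparts n) = (\<Sum>M\<in>odd_msets n. 2 ^ card (set_mset M))"
  by (simp add: odd_overparts_eq_Sigma card_SigmaI finite_odd_msets card_Pow)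

lemma card_odd_overparts_0: "card (odd_overparts 0) = 1"
proof -
  have "odd_msets 0 = {{#}}"
    by (auto simp: odd_msets_def) (metis even_zero multiset_nonemptyE)
  then show ?thesis
    by (simp add: card_odd_overparts)
qed

text \<open>A partition of a positive number has at least one part size, so every weight is even.
  This makes the halves in the series \<open>U\<close> of \<open>OPT_3_cong\<close> exact.\<close>

lemma even_card_odd_overparts: "n > 0 \<Longrightarrow> even (card (odd_overparts n))"
  unfolding card_odd_overparts
  by (rule dvd_sum) (auto simp: odd_msets_def card_gt_0_iff)

lemma OPT_3_cong:
  assumes "odd n"
  shows "[int (OPT 3 (int n)) = 3 * int (card (odd_overparts n))] (mod 8)"
proof -
  define A where "A = Abs_fps (\<lambda>n. int (card (odd_overparts n)))"
  \<comment> \<open>The value 0 at \<open>n = 0\<close> removes the constant term 1 of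
    \<open>A\<close>.\<close>
  define U where "U = Abs_fps (\<lambda>n. if n = 0 then 0 else int (card (odd_overparts n)) div 2)"
  have A: "A = 1 + fps_const 2 * U"
    by (rule fps_ext) (use card_odd_overparts_0 even_card_odd_overparts in \<open>auto simp: A_def U_def\<close>)
  have "A ^ 3 = 1 + fps_const 6 * U + fps_const 12 * U ^ 2 + fps_const 8 * U ^ 3"
    unfolding A by (simp add: power3_eq_cube power2_eq_square algebra_simps numeral_fps_const[symmetric])
  then have "int (OPT 3 (int n)) = 6 * fps_nth U n + 12 * fps_nth (U ^ 2) n + 8 * fps_nth (U ^ 3) n"
    using arg_cong[OF OPT_gf[of 3], of "\<lambda>F. fps_nth F n"] odd_pos[OF assms]
    by (simp flip: A_def)
  moreover have "3 * int (card (odd_overparts n)) = 6 * fps_nth U n"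
    using odd_pos[OF assms] even_card_odd_overparts[of n] by (auto simp: U_def)
  moreover obtain c where "fps_nth (U ^ 2) n = 2 * c"
    using even_fps_square_nth_odd[OF assms, of U] by (elim evenE)
  \<comment> \<open>The linear terms cancel, and \<open>12 * (2 * c) = 8 * (3 * c)\<close>.\<close>
  ultimately have "int (OPT 3 (int n)) - 3 * int (card (odd_overparts n)) = 8 * (3 * c + fps_nth (U ^ 3) n)"
    by simp
  then show ?thesis
    by (simp add: cong_iff_dvd_diff)
qed

section \<open>One or two part sizes\<close>

text \<open>A partition with the single part size \<open>d\<close> consists of
  \<open>n div d\<close> copies of \<open>d\<close>, so it is determined by the odd divisor
  \<open>d\<close>.\<close>

lemma card_odd_msets_one_size:
  assumes "n > 0"
  shows "card {M \<in> odd_msets n. card (set_mset M) = 1} = card {d. odd d \<and> d dvd n}"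
proof -
  have "bij_betw (\<lambda>d. replicate_mset (n div d) d) {d. odd d \<and> d dvd n}
      {M \<in> odd_msets n. card (set_mset M) = 1}"
  proof (rule bij_betwI')
    have set: "set_mset (replicate_mset (n div d) d) = {d}" if "d dvd n" for d
      using that assms by (simp add: dvd_div_eq_0_iff)
    fix d e assume "d \<in> {d. odd d \<and> d dvd n}" "e \<in> {d. odd d \<and> d dvd n}"
    with set[of d] set[of e] show "(replicate_mset (n div d) d = replicate_mset (n div e) e) = (d = e)"
      by (metis mem_Collect_eq singleton_inject)
  next
    fix d assume "d \<in> {d. odd d \<and> d dvd n}"
    with assms show "replicate_mset (n div d) d \<in> {M \<in> odd_msets n. card (set_mset M) = 1}"
      by (auto simp: odd_msets_def dvd_div_eq_0_iff split: if_splits)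
  next
    fix M assume M: "M \<in> {M \<in> odd_msets n. card (set_mset M) = 1}"
    then obtain d where d: "set_mset M = {d}"
      by (auto simp: card_1_singleton_iff)
    then have M': "M = replicate_mset (size M) d"
      by (metis set_mset_subset_singletonD subset_refl)
    have "size M * d = n" "odd d"
      using M d M' by (auto simp: odd_msets_def) (metis sum_mset_replicate_mset of_nat_id)
    then have "n div d = size M" "d dvd n"
      using odd_pos[of d] by auto
    with M' \<open>odd d\<close> show "\<exists>d\<in>{d. odd d \<and> d dvd n}. M = replicate_mset (n div d) d"
      by auto
  qed
  then show ?thesis
    by (simp add: bij_betw_same_card)
qed

text \<open>Here \<open>m\<close> and \<open>l\<close> are the multiplicities of the sizes
  \<open>d\<close> and \<open>e\<close>; the order \<open>d < e\<close> makes the encoding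
  unique.\<close>

lemma card_odd_msets_two_sizes:
  "card {M \<in> odd_msets n. card (set_mset M) = 2} =
    card {(d, m, e, l). odd d \<and> odd e \<and> 0 < m \<and> 0 < l \<and> d * m + e * l = n \<and> d < e}"
    (is "card ?M = card ?Q")
proof -
  let ?f = "\<lambda>(d, m, e, l). replicate_mset m d + replicate_mset l e :: nat multiset"
  have "bij_betw ?f ?Q ?M"
  proof (rule bij_betw_imageI)
    show "inj_on ?f ?Q"
    proof (rule inj_onI, clarify)
      fix d m e l d' m' e' l' :: nat
      assume pos: "0 < m" "0 < l" "0 < m'" "0 < l'" and lt: "d < e" "d' < e'"
        and eq: "replicate_mset m d + replicate_mset l e = replicate_mset m' d' + replicate_mset l' e'"
      have "{d, e} = {d', e'}"
        using arg_cong[OF eq, of set_mset] pos by (auto split: if_splits)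
      with lt have de: "d' = d" "e' = e"
        by (auto simp: doubleton_eq_iff)
      have "m' = m" "l' = l"
        using arg_cong[OF eq, of "\<lambda>M. count M d"] arg_cong[OF eq, of "\<lambda>M. count M e"] lt
        by (auto simp: de)
      with de show "d = d' \<and> (m, e, l) = (m', e', l')"
        by simp
    qed
    show "?f ` ?Q = ?M"
    proof (intro equalityI subsetI)
      fix M assume "M \<in> ?f ` ?Q"
      then show "M \<in> ?M"
        by (auto simp: odd_msets_def mult.commute split: if_splits)
    next
      fix M assume M: "M \<in> ?M"
      then obtain d e where de: "set_mset M = {d, e}" "d < e"
        by (auto simp: card_2_iff) (metis insert_commute linorder_neqE_nat)
      have M': "M = replicate_mset (count M d) d + replicate_mset (count M e) e"
      proof (rule multiset_eqI)
        fix x show "count M x = count (replicate_mset (count M d) d + replicate_mset (count M e) e) x"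
          using de by (cases "x \<in># M") (auto simp: count_eq_zero_iff)
      qed
      have "sum_mset M = count M d * d + count M e * e"
        using arg_cong[OF M', of sum_mset] by simp
      then have "(d, count M d, e, count M e) \<in> ?Q"
        using M de by (auto simp: odd_msets_def mult.commute)
      with M' show "M \<in> ?f ` ?Q"
        by (intro image_eqI[where x = "(d, count M d, e, count M e)"]) auto
    qed
  qed
  then show ?thesis
    by (rule bij_betw_same_card[symmetric])
qed

text \<open>One and two part sizes have weights 2 and 4, while from three sizes on the weight is
  divisible by 8.\<close>

lemma card_odd_overparts_cong:
  assumes "n > 0"
  shows "[card (odd_overparts n) = 2 * card {d. odd d \<and> d dvd n} +
    4 * card {(d, m, e, l). odd d \<and> odd e \<and> 0 < m \<and> 0 < l \<and> d * m + e * l = n \<and> d < e}] (mod 8)"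
proof -
  let ?I = "\<lambda>i. {M \<in> odd_msets n. card (set_mset M) = i}"
  let ?R = "{M \<in> odd_msets n. card (set_mset M) \<ge> 3}"
  have pos: "card (set_mset M) \<noteq> 0" if "M \<in> odd_msets n" for M
    using that assms by (auto simp: odd_msets_def)
  have split: "odd_msets n = ?I 1 \<union> ?I 2 \<union> ?R"
    using pos by (force simp: not_less_eq_eq numeral_eq_Suc le_Suc_eq)
  have "card (odd_overparts n) = (\<Sum>M\<in>?I 1 \<union> ?I 2 \<union> ?R. 2 ^ card (set_mset M))"
    unfolding card_odd_overparts using split by (rule arg_cong)
  also have "\<dots> = (\<Sum>M\<in>?I 1. 2 ^ card (set_mset M)) + (\<Sum>M\<in>?I 2. 2 ^ card (set_mset M)) +
      (\<Sum>M\<in>?R. 2 ^ card (set_mset M))"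
    using finite_odd_msets[of n] by (subst sum.union_disjoint, auto)+
  also have "\<dots> = 2 * card (?I 1) + 4 * card (?I 2) + (\<Sum>M\<in>?R. 2 ^ card (set_mset M))"
    by simp
  finally have eq: "card (odd_overparts n) = 2 * card (?I 1) + 4 * card (?I 2) + (\<Sum>M\<in>?R. 2 ^ card (set_mset M))" .
  have "8 dvd (\<Sum>M\<in>?R. 2 ^ card (set_mset M) :: nat)"
  proof (rule dvd_sum)
    fix M assume "M \<in> ?R"
    then have "2 ^ 3 dvd (2 ^ card (set_mset M) :: nat)"
      by (intro le_imp_power_dvd) auto
    then show "8 dvd (2 ^ card (set_mset M) :: nat)"
      by simp
  qed
  then show ?thesis
    unfolding eq card_odd_msets_one_size[OF assms] card_odd_msets_two_sizes
    by (auto simp: cong_def elim!: dvdE)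
qed

section \<open>Representations by binary quadratic forms\<close>

text \<open>Pigeonhole: there are more than \<open>p\<close> pairs with entries up to the integer
  square root of \<open>p\<close>, so two of them give the same residue of
  \<open>y * a - x * b\<close>, and their difference is the required pair.\<close>

lemma Thue:
  fixes x y :: int
  assumes "prime p"
  obtains a b :: int where "(a, b) \<noteq> (0, 0)" "a ^ 2 < int p" "b ^ 2 < int p" "int p dvd y * a - x * b"
proof -
  define k where "k = floor_sqrt p"
  define A where "A = {0..int k} \<times> {0..int k}"
  define f where "f = (\<lambda>(a, b). (y * a - x * b) mod int p)"
  have p: "p > 0"
    using assms by (rule prime_gt_0_nat)
  have "card (f ` A) \<le> card {0..<int p}"
    by (rule card_mono) (use p in \<open>auto simp: f_def\<close>)
  also have "\<dots> < (Suc k) ^ 2"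
    using Suc_floor_sqrt_power2_gt[of p] by (simp add: k_def)
  also have "\<dots> = card A"
    by (simp add: A_def card_cartesian_product power2_eq_square nat_add_distrib)
  finally have "\<not> inj_on f A"
    by (rule pigeonhole)
  then obtain a b c d where abcd: "(a, b) \<in> A" "(c, d) \<in> A" "(a, b) \<noteq> (c, d)" "f (a, b) = f (c, d)"
    by (auto simp: inj_on_def)
  have small: "(u - v) ^ 2 < int p" if "u \<in> {0..int k}" "v \<in> {0..int k}" for u v
  proof -
    have "(u - v) ^ 2 \<le> int k ^ 2"
      using that by (intro abs_le_square_iff[THEN iffD1]) auto
    also have "\<dots> < int p"
    proof -
      \<comment> \<open>The bound is strict because a prime is not a square.\<close>
      have "k ^ 2 \<noteq> p"
        using assms prime_power_iff[of k 2] by auto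
      moreover have "k ^ 2 \<le> p"
        by (simp add: k_def)
      ultimately show ?thesis
        by (simp flip: of_nat_power)
    qed
    finally show ?thesis .
  qed
  show ?thesis
  proof (rule that)
    show "(a - c, b - d) \<noteq> (0, 0)"
      using abcd by auto
    show "(a - c) ^ 2 < int p" "(b - d) ^ 2 < int p"
      using abcd by (auto simp: A_def intro!: small)
    have "int p dvd (y * a - x * b) - (y * c - x * d)"
      using abcd(4) by (simp add: f_def mod_eq_dvd_iff)
    then show "int p dvd y * (a - c) - x * (b - d)"
      by (simp add: algebra_simps)
  qed
qed

lemma odd_prime_not_dvd_2: "prime p \<Longrightarrow> odd p \<Longrightarrow> \<not> int p dvd 2"
  using zdvd_imp_le[of "int p" 2] prime_ge_2_nat[of p] by (cases "p = 2") auto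

text \<open>Thue's lemma yields a positive value of the form that is a multiple \<open>p * c\<close>
  below \<open>(1 + E) * p\<close>. Hence \<open>c = 1\<close>, or \<open>c = E = 2\<close>, where a
  factor 2 can be removed.\<close>

lemma prime_eq_form_1_2:
  fixes x y E :: int
  assumes p: "prime p" "odd p" and E: "E \<in> {1, 2}"
    and dvd: "int p dvd x ^ 2 + E * y ^ 2" and y: "\<not> int p dvd y"
  shows "\<exists>a b. int p = a ^ 2 + E * b ^ 2"
proof -
  obtain a b where ab: "(a, b) \<noteq> (0, 0)" "a ^ 2 < int p" "b ^ 2 < int p" "int p dvd y * a - x * b"
    using Thue[OF p(1)] .
  \<comment> \<open>The factor \<open>y ^ 2\<close> takes the place of an inverse of
    \<open>y\<close> modulo \<open>p\<close>; it is cancelled afterwards since \<open>p\<close> does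
    not divide \<open>y\<close>.\<close>
  have "y ^ 2 * (a ^ 2 + E * b ^ 2) = (y * a - x * b) * (y * a + x * b) + b ^ 2 * (x ^ 2 + E * y ^ 2)"
    by (simp add: algebra_simps power2_eq_square)
  also have "int p dvd \<dots>"
    using dvd_mult2[OF ab(4)] dvd_mult[OF dvd] by (rule dvd_add)
  finally have "int p dvd a ^ 2 + E * b ^ 2"
    using y p(1) by (simp add: prime_dvd_mult_iff prime_dvd_power_iff)
  then obtain c where c: "a ^ 2 + E * b ^ 2 = int p * c"
    by (elim dvdE)
  have "a ^ 2 + E * b ^ 2 > 0"
    using ab(1) E by (auto simp: add_pos_nonneg add_nonneg_pos)
  with c have "c > 0"
    by (simp add: zero_less_mult_iff)
  moreover have "int p * c < int p * (1 + E)"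
    using ab(2,3) E c by auto
  then have "c < 1 + E"
    using mult_less_cancel_left_pos[of "int p" c "1 + E"] prime_gt_0_nat[OF p(1)] by simp
  ultimately consider "c = 1" | "E = 2" "c = 2"
    using E by force
  then show ?thesis
  proof cases
    case 1
    then show ?thesis
      using c by (metis mult.right_neutral)
  next
    case 2
    then have "even (a ^ 2)"
      using c by (metis dvd_add_left_iff dvd_triv_left dvd_triv_right)
    then obtain a' where "a = 2 * a'"
      by auto
    \<comment> \<open>Halving \<open>4 * a' ^ 2 + 2 * b ^ 2 = 2 * p\<close> exchanges the roles of
      the two squares.\<close>
    then have "int p = b ^ 2 + E * a' ^ 2"
      using c 2 by (simp add: power2_eq_square)
    then show ?thesis
      by blast
  qed
qed

text \<open>For \<open>D = 4\<close> the value is \<open>x ^ 2 + (2 * y) ^ 2\<close>, so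
  \<open>p\<close> is a sum of two squares; as \<open>p\<close> is odd, one of them is even and
  supplies the factor 4.\<close>

lemma prime_eq_form_2_4:
  fixes x y D :: int
  assumes p: "prime p" "odd p" and D: "D \<in> {2, 4}"
    and dvd: "int p dvd x ^ 2 + D * y ^ 2" and y: "\<not> int p dvd y"
  shows "\<exists>a b. int p = a ^ 2 + D * b ^ 2"
proof (cases "D = 2")
  case True
  then show ?thesis
    using prime_eq_form_1_2[of p D x y] assms by auto
next
  case False
  then have D4: "D = 4"
    using D by simp
  have "\<not> int p dvd 2"
    using p by (rule odd_prime_not_dvd_2)
  then have "\<not> int p dvd 2 * y"
    using y p by (simp add: prime_dvd_mult_iff)
  moreover have "int p dvd x ^ 2 + 1 * (2 * y) ^ 2"
    using dvd by (simp add: D4 power_mult_distrib)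
  ultimately obtain a b where ab: "int p = a ^ 2 + b ^ 2"
    using prime_eq_form_1_2[of p 1 x "2 * y"] p by auto
  have "odd (a ^ 2 + b ^ 2)"
    using p unfolding ab[symmetric] by simp
  then consider "even a" | "even b"
    by auto
  then show ?thesis
  proof cases
    case 1
    then obtain c where "a = 2 * c" by (elim evenE)
    then have "int p = b ^ 2 + D * c ^ 2"
      using ab D4 by (simp add: power_mult_distrib)
    then show ?thesis by blast
  next
    case 2
    then obtain c where "b = 2 * c" by (elim evenE)
    then have "int p = a ^ 2 + D * c ^ 2"
      using ab D4 by (simp add: power_mult_distrib)
    then show ?thesis by blast
  qed
qed

section \<open>Counting integer representations along powers of a prime\<close>

text \<open>Signs and zeros are allowed because multiplication of numbers
  \<open>x + y sqrt(-D)\<close> does not preserve positivity of the coordinates.\<close>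

definition form_reps :: "int \<Rightarrow> int \<Rightarrow> (int \<times> int) set" where
  "form_reps D m = {(x, y). x ^ 2 + D * y ^ 2 = m}"

lemma finite_form_reps:
  assumes "D > 0"
  shows "finite (form_reps D m)"
proof (rule finite_subset)
  show "form_reps D m \<subseteq> {-m..m} \<times> {-m..m}"
  proof (rule subrelI)
    fix x y assume "(x, y) \<in> form_reps D m"
    then have m: "x ^ 2 + D * y ^ 2 = m"
      by (simp add: form_reps_def)
    have sq: "\<bar>z\<bar> \<le> z ^ 2" for z :: int
      using self_le_power[of "\<bar>z\<bar>" 2] by (cases "z = 0") auto
    have "y ^ 2 \<le> D * y ^ 2"
      using assms by (simp add: mult_le_cancel_right1)
    then have "\<bar>x\<bar> \<le> m" "\<bar>y\<bar> \<le> m"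
      using sq[of x] sq[of y] m zero_le_power2[of x] zero_le_power2[of y] by linarith+
    then show "(x, y) \<in> {-m..m} \<times> {-m..m}"
      by auto
  qed
qed auto

text \<open>Multiplicativity of the norm for the product of \<open>x + y sqrt(-D)\<close> and
  \<open>a + b sqrt(-D)\<close>.\<close>

lemma Brahmagupta_identity:
  fixes a b x y D :: int
  shows "(x * a - D * y * b) ^ 2 + D * (x * b + y * a) ^ 2 = (a ^ 2 + D * b ^ 2) * (x ^ 2 + D * y ^ 2)"
  by (simp add: algebra_simps power2_eq_square)

text \<open>
  In terms of \<open>z = x + y \<surd>(-D)\<close> and \<open>\<pi> = a + b \<surd>(-D)\<close>, an element of norm \<open>p * m\<close> is
  divisible by \<open>\<pi>\<close> or by its conjugate; dividing gives elements of norm \<open>m\<close>, and \<open>z\<close> is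
  divisible by both exactly if it is divisible by \<open>p\<close>.
\<close>

lemma card_form_reps_prime_mult:
  fixes a b D m p :: int
  assumes D: "D > 0" and p: "prime p" "p = a ^ 2 + D * b ^ 2" "\<not> p dvd 2 * D"
  shows "card (form_reps D (p * m)) + card {(x, y) \<in> form_reps D (p * m). p dvd x \<and> p dvd y} =
    2 * card (form_reps D m)"
proof -
  let ?R = "form_reps D (p * m)"
  \<comment> \<open>Up to sign, the tested quantities are the coefficients of
    \<open>sqrt(-D)\<close> in \<open>z\<close> times \<open>\<pi>\<close> and in \<open>z\<close>
    times its conjugate. So \<open>?U\<close> holds the \<open>z\<close> divisible by the conjugate
    of \<open>\<pi>\<close>, and \<open>?V\<close> those divisible by \<open>\<pi>\<close>.\<close>
  let ?U = "{(x, y) \<in> ?R. p dvd x * b + y * a}"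
  let ?V = "{(x, y) \<in> ?R. p dvd x * b - y * a}"
  let ?W = "{(x, y) \<in> ?R. p dvd x \<and> p dvd y}"
  have p0: "p > 0"
    using p(1) by (rule prime_gt_0_int)
  have p_small: "\<not> p dvd z" if "z ^ 2 < p" "z \<noteq> 0" for z
  proof
    assume "p dvd z"
    then have "p \<le> \<bar>z\<bar>"
      using that(2) by (intro zdvd_imp_le) auto
    also have "\<bar>z\<bar> \<le> z ^ 2"
      using that(2) self_le_power[of "\<bar>z\<bar>" 2] by auto
    finally show False
      using that(1) by simp
  qed
  have not_sq: "z ^ 2 \<noteq> p" for z
    using p(1) prime_power_iff[of z 2] by auto
  have b0: "b \<noteq> 0"
    using p(2) not_sq[of a] by auto
  have a0: "a \<noteq> 0"
  proof
    assume "a = 0"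
    then have "p = (D * b) * b"
      using p(2) by (simp add: power2_eq_square)
    then have "p dvd D * b \<or> p dvd b"
      using p(1) by (metis dvd_refl prime_dvd_mult_iff)
    then have "p dvd b"
      using p(1,3) by (auto simp: prime_dvd_mult_iff)
    then obtain c where "b = p * c"
      by (elim dvdE)
    with \<open>p = (D * b) * b\<close> have "p * (p * (D * c ^ 2)) = p * 1"
      by (simp add: power2_eq_square algebra_simps)
    then have "p * (D * c ^ 2) = 1"
      using p0 by (simp only: mult_cancel_left) simp
    then have "p dvd 1"
      by (metis dvd_triv_left)
    with p(1) show False
      by auto
  qed
  have "a ^ 2 < p" "D * b ^ 2 < p"
    using p(2) a0 b0 D by auto
  moreover have "b ^ 2 \<le> D * b ^ 2"
    using mult_right_mono[of 1 D "b ^ 2"] D by simp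
  ultimately have pab: "\<not> p dvd a" "\<not> p dvd b"
    using p_small[of a] p_small[of b] a0 b0 by linarith+
  have R: "?R = ?U \<union> ?V"
  proof -
    have "p dvd x * b + y * a \<or> p dvd x * b - y * a" if "(x, y) \<in> ?R" for x y
    proof -
      have "x ^ 2 + D * y ^ 2 = p * m"
        using that by (simp add: form_reps_def)
      \<comment> \<open>Both terms on the right are multiples of \<open>p\<close>, so the prime
        \<open>p\<close> divides one of the two factors on the left.\<close>
      moreover have "(x * b + y * a) * (x * b - y * a) =
          b ^ 2 * (x ^ 2 + D * y ^ 2) - y ^ 2 * (a ^ 2 + D * b ^ 2)"
        by (simp add: algebra_simps power2_eq_square)
      ultimately have "(x * b + y * a) * (x * b - y * a) = p * (b ^ 2 * m - y ^ 2)"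
        unfolding p(2)[symmetric] by (simp add: algebra_simps)
      then show ?thesis
        using p(1) by (metis dvd_triv_left prime_dvd_mult_iff)
    qed
    then show ?thesis
      by blast
  qed
  have W: "?U \<inter> ?V = ?W"
  proof -
    have "p dvd x \<and> p dvd y" if "p dvd x * b + y * a" "p dvd x * b - y * a" for x y
    proof -
      have "p dvd 2 * (x * b)" "p dvd 2 * (y * a)"
        using dvd_add[OF that] dvd_diff[OF that] by (simp_all add: algebra_simps)
      moreover have "\<not> p dvd 2"
        using p(3) by auto
      ultimately show ?thesis
        using p(1) pab by (simp add: prime_dvd_mult_iff)
    qed
    moreover have "p dvd x * b + y * a \<and> p dvd x * b - y * a" if "p dvd x" "p dvd y" for x y
      using that by simp
    ultimately show ?thesis
      by blast
  qed
  have V: "card ?V = card ?U"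
  proof (rule bij_betw_same_card[of "\<lambda>(x, y). (x, - y)"])
    show "bij_betw (\<lambda>(x, y). (x, - y)) ?V ?U"
      by (rule bij_betw_byWitness[where f' = "\<lambda>(x, y). (x, - y)"]) (auto simp: form_reps_def)
  qed
  have U: "card (form_reps D m) = card ?U"
  proof (rule bij_betw_same_card)
    \<comment> \<open>\<open>?f\<close> multiplies by the conjugate of \<open>\<pi>\<close>; its
      inverse \<open>?g\<close> multiplies by \<open>\<pi>\<close> and divides by
      \<open>p\<close>.\<close>
    let ?f = "\<lambda>(s, t). (s * a + D * t * b, t * a - s * b)"
    let ?g = "\<lambda>(x, y). ((x * a - D * y * b) div p, (x * b + y * a) div p)"
    have gf: "?g (?f st) = st" for st
    proof (cases st)
      case (Pair s t)
      have "(s * a + D * t * b) * a - D * (t * a - s * b) * b = p * s"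
        "(s * a + D * t * b) * b + (t * a - s * b) * a = p * t"
        by (simp_all add: p(2) algebra_simps power2_eq_square)
      with Pair p0 show ?thesis
        by simp
    qed
    have fg: "?f (?g xy) = xy \<and> ?g xy \<in> form_reps D m" if "xy \<in> ?U" for xy
    proof (cases xy)
      case (Pair x y)
      with that have R: "x ^ 2 + D * y ^ 2 = p * m" and t: "p dvd x * b + y * a"
        by (auto simp: form_reps_def)
      have norm: "(x * a - D * y * b) ^ 2 + D * (x * b + y * a) ^ 2 = p * (p * m)"
        unfolding Brahmagupta_identity R p(2)[symmetric] ..
      obtain t where t: "x * b + y * a = p * t"
        using t by (elim dvdE)
      \<comment> \<open>The second coordinate of \<open>z * \<pi>\<close> is divisible by
        \<open>p\<close> and the norm is \<open>p * (p * m)\<close>, which forces \<open>p\<close>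
        to divide the first coordinate too.\<close>
      have "p dvd (x * a - D * y * b) ^ 2"
      proof -
        have "(x * a - D * y * b) ^ 2 = p * (p * m - D * p * t ^ 2)"
          using norm unfolding t by (simp add: algebra_simps power2_eq_square)
        then show ?thesis
          by simp
      qed
      then obtain s where s: "x * a - D * y * b = p * s"
        using p(1) prime_dvd_power by (metis dvdE)
      have "p * p * (s ^ 2 + D * t ^ 2) = p * p * m"
        using norm unfolding s t by (simp add: algebra_simps power2_eq_square)
      then have "s ^ 2 + D * t ^ 2 = m"
        using p0 by simp
      moreover have "p * (s * a + D * t * b) = p * x"
      proof -
        have "p * (s * a + D * t * b) = (x * a - D * y * b) * a + D * (x * b + y * a) * b"
          unfolding s t by (simp add: algebra_simps)
        also have "\<dots> = (a ^ 2 + D * b ^ 2) * x"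
          by (simp add: algebra_simps power2_eq_square)
        finally show ?thesis
          unfolding p(2)[symmetric] .
      qed
      moreover have "p * (t * a - s * b) = p * y"
      proof -
        have "p * (t * a - s * b) = (x * b + y * a) * a - (x * a - D * y * b) * b"
          unfolding s t by (simp add: algebra_simps)
        also have "\<dots> = (a ^ 2 + D * b ^ 2) * y"
          by (simp add: algebra_simps power2_eq_square)
        finally show ?thesis
          unfolding p(2)[symmetric] .
      qed
      ultimately have "s ^ 2 + D * t ^ 2 = m" "s * a + D * t * b = x" "t * a - s * b = y"
        using p0 by simp_all
      then show ?thesis
        using Pair s t p0 by (simp add: form_reps_def)
    qed
    have f: "?f st \<in> ?U" if "st \<in> form_reps D m" for st
    proof (cases st)
      case (Pair s t)
      with that have "s ^ 2 + D * t ^ 2 = m"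
        by (simp add: form_reps_def)
      then have "(s * a + D * t * b) ^ 2 + D * (t * a - s * b) ^ 2 = p * m"
        using Brahmagupta_identity[of s a D t "- b"] p(2) by (simp add: algebra_simps)
      moreover have "(s * a + D * t * b) * b + (t * a - s * b) * a = p * t"
        by (simp add: p(2) algebra_simps power2_eq_square)
      ultimately show ?thesis
        using Pair by (simp add: form_reps_def)
    qed
    show "bij_betw ?f (form_reps D m) ?U"
      by (rule bij_betw_byWitness[where f' = ?g])
        (rule ballI gf image_subsetI f conjunct1[OF fg] conjunct2[OF fg], assumption?)+
  qed
  have fin: "finite ?U" "finite ?V"
    by (rule finite_subset[OF _ finite_form_reps[OF D, of "p * m"]], blast)+
  show ?thesis
    using card_Un_Int[OF fin] U V unfolding W R[symmetric] by simp
qed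

lemma card_form_reps_dvd_prime:
  fixes D m p :: int
  assumes "p \<noteq> 0"
  shows "card {(x, y) \<in> form_reps D (p * (p * m)). p dvd x \<and> p dvd y} = card (form_reps D m)"
proof -
  have eq: "(p * x) ^ 2 + D * (p * y) ^ 2 = p * (p * n) \<longleftrightarrow> x ^ 2 + D * y ^ 2 = n" for x y n
  proof -
    have "(p * x) ^ 2 + D * (p * y) ^ 2 = p * (p * (x ^ 2 + D * y ^ 2))"
      by (simp add: algebra_simps power2_eq_square)
    then show ?thesis
      using assms by simp
  qed
  have "bij_betw (\<lambda>(x, y). (p * x, p * y)) (form_reps D m)
      {(x, y) \<in> form_reps D (p * (p * m)). p dvd x \<and> p dvd y}"
    by (rule bij_betw_byWitness[where f' = "\<lambda>(x, y). (x div p, y div p)"])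
      (use assms in \<open>auto simp: form_reps_def eq elim!: dvdE\<close>)
  then show ?thesis
    by (rule bij_betw_same_card[symmetric])
qed

text \<open>Writing r for the number of representations, the two preceding lemmas give
  \<open>r(p^(v+2) m) + r(p^v m) = 2 r(p^(v+1) m)\<close>. The counts thus form an arithmetic
  progression starting with r(m) and 2 r(m); the second value holds since \<open>p\<close> dividing
  both coordinates would give \<open>p dvd m\<close>.\<close>

lemma card_form_reps_prime_power_mult:
  fixes a b D m p :: int
  assumes D: "D > 0" and p: "prime p" "p = a ^ 2 + D * b ^ 2" "\<not> p dvd 2 * D" and m: "\<not> p dvd m"
  shows "card (form_reps D (p ^ v * m)) = (v + 1) * card (form_reps D m)"
proof (induction v rule: induct_nat_012)
  case 0
  show ?case by simp
next
  case 1
  have "{(x, y) \<in> form_reps D (p * m). p dvd x \<and> p dvd y} = {}"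
  proof -
    have False if "p dvd x" "p dvd y" "x ^ 2 + D * y ^ 2 = p * m" for x y
    proof -
      from that(1,2) obtain s t where "x = p * s" "y = p * t"
        by (elim dvdE)
      with that(3) have "p * (p * (s ^ 2 + D * t ^ 2)) = p * m"
        by (simp add: algebra_simps power2_eq_square)
      then have "p * (s ^ 2 + D * t ^ 2) = m"
        using p(1) by simp
      with m show False
        by auto
    qed
    then show ?thesis
      by (auto simp: form_reps_def)
  qed
  with card_form_reps_prime_mult[OF D p, of m] show ?case
    by simp
next
  case (ge2 v)
  have "p \<noteq> 0"
    using p(1) by auto
  then show ?case
    using card_form_reps_prime_mult[OF D p, of "p * (p ^ v * m)"]
      card_form_reps_dvd_prime[of p D "p ^ v * m"] ge2
    by (simp add: algebra_simps)
qed

text \<open>Descent: for an inert \<open>p\<close> every solution has both coordinates divisible by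
  \<open>p\<close>, so the exponent of \<open>p\<close> drops by two. An odd exponent ends at
  \<open>p * m\<close>, where \<open>p dvd m\<close> would follow.\<close>

lemma form_reps_prime_power_mult_empty:
  fixes D m p :: int
  assumes p: "prime p" and m: "\<not> p dvd m"
    and inert: "\<And>x y. p dvd x ^ 2 + D * y ^ 2 \<Longrightarrow> p dvd y"
  shows "form_reps D (p ^ (2 * k + 1) * m) = {}"
proof (induction k)
  have descent: "p dvd n \<and> form_reps D (n div p) \<noteq> {}" if "(x, y) \<in> form_reps D (p * n)" for x y n
  proof -
    have xy: "x ^ 2 + D * y ^ 2 = p * n"
      using that by (simp add: form_reps_def)
    then have y: "p dvd y"
      using inert by (metis dvd_triv_left)
    have "x ^ 2 = p * n - D * y ^ 2"
      using xy by simp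
    also have "p dvd \<dots>"
      using y by (simp add: power2_eq_square)
    finally have "p dvd x"
      using p prime_dvd_power by blast
    then obtain s t where "x = p * s" "y = p * t"
      using y by (elim dvdE)
    with xy have "p * (p * (s ^ 2 + D * t ^ 2)) = p * n"
      by (simp add: algebra_simps power2_eq_square)
    then have n: "n = p * (s ^ 2 + D * t ^ 2)"
      using p by simp
    moreover have "(s, t) \<in> form_reps D (s ^ 2 + D * t ^ 2)"
      by (simp add: form_reps_def)
    ultimately show ?thesis
      using p by auto
  qed
  {
    case 0
    show ?case
      using descent[of _ _ m] m by auto
  next
    case (Suc k)
    have eq: "p ^ (2 * Suc k + 1) * m = p * (p * (p ^ (2 * k + 1) * m))"
      by simp
    show ?case
    proof (rule equals0I)
      fix z assume "z \<in> form_reps D (p ^ (2 * Suc k + 1) * m)"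
      then have "form_reps D (p * (p ^ (2 * k + 1) * m) div p) \<noteq> {}"
        unfolding eq using descent by (cases z) blast
      with p Suc show False
        by simp
    qed
  }
qed

section \<open>Positive representations and their parity\<close>

definition pos_form_reps :: "nat \<Rightarrow> nat \<Rightarrow> (nat \<times> nat) set" where
  "pos_form_reps D n = {(x, y). 0 < x \<and> 0 < y \<and> x ^ 2 + D * y ^ 2 = n}"

text \<open>Off the axes, every solution is a positive one with one of four choices of
  signs.\<close>

lemma card_form_reps_eq_4_pos:
  assumes "\<And>x y. (x, y) \<in> form_reps (int D) (int n) \<Longrightarrow> x \<noteq> 0 \<and> y \<noteq> 0"
  shows "card (form_reps (int D) (int n)) = 4 * card (pos_form_reps D n)"
proof -
  let ?S = "{1, -1 :: int} \<times> {1, -1 :: int}"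
  have "bij_betw (\<lambda>((x, y), (s, t)). (s * int x, t * int y)) (pos_form_reps D n \<times> ?S)
      (form_reps (int D) (int n))"
  proof (rule bij_betw_byWitness[where f' = "\<lambda>(x, y). ((nat \<bar>x\<bar>, nat \<bar>y\<bar>), (sgn x, sgn y))"])
    show "(\<lambda>((x, y), (s, t)). (s * int x, t * int y)) ` (pos_form_reps D n \<times> ?S) \<subseteq> form_reps (int D) (int n)"
      by (auto simp: pos_form_reps_def form_reps_def)
    show "(\<lambda>(x, y). ((nat \<bar>x\<bar>, nat \<bar>y\<bar>), (sgn x, sgn y))) ` form_reps (int D) (int n) \<subseteq> pos_form_reps D n \<times> ?S"
    proof (rule image_subsetI, unfold split_paired_all prod.case)
      fix x y assume xy: "(x, y) \<in> form_reps (int D) (int n)"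
      then have "int (nat \<bar>x\<bar> ^ 2 + D * nat \<bar>y\<bar> ^ 2) = int n"
        by (simp add: form_reps_def)
      then have "nat \<bar>x\<bar> ^ 2 + D * nat \<bar>y\<bar> ^ 2 = n"
        by (simp only: of_nat_eq_iff)
      with assms[OF xy] show "((nat \<bar>x\<bar>, nat \<bar>y\<bar>), (sgn x, sgn y)) \<in> pos_form_reps D n \<times> ?S"
        by (auto simp: pos_form_reps_def sgn_if)
    qed
  qed (auto simp: pos_form_reps_def abs_mult sgn_mult sgn_mult_abs)
  then have "card (form_reps (int D) (int n)) = card (pos_form_reps D n \<times> ?S)"
    by (rule bij_betw_same_card[symmetric])
  then show ?thesis
    by (simp add: card_cartesian_product)
qed

lemma even_card_pos_form_reps:
  assumes p: "prime p" "odd p" and v: "odd v" and m: "\<not> p dvd m" "odd m" "\<And>s. m \<noteq> s ^ 2"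
    and n: "\<And>s. p ^ v * m \<noteq> s ^ 2" and D: "D \<in> {2, 4}"
  shows "even (card (pos_form_reps D (p ^ v * m)))"
proof (cases "\<exists>a b. int p = a ^ 2 + int D * b ^ 2")
  case True
  then obtain a b where ab: "int p = a ^ 2 + int D * b ^ 2"
    by blast
  have "\<not> int p dvd 2"
    using p by (rule odd_prime_not_dvd_2)
  moreover have "2 * int D = 2 * 2 \<or> 2 * int D = 2 * (2 * 2)"
    using D by auto
  ultimately have "\<not> int p dvd 2 * int D"
    using p(1) by (metis prime_dvd_mult_iff prime_nat_int_transfer)
  then have *: "card (form_reps (int D) (int p ^ v * int m)) = (v + 1) * card (form_reps (int D) (int m))"
    using D p m by (intro card_form_reps_prime_power_mult[OF _ _ ab]) auto
  \<comment> \<open>A solution with \<open>x = 0\<close> would make \<open>k\<close> even, one with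
    \<open>y = 0\<close> would make it a square. Hence the signed counts for \<open>m\<close> and
    for \<open>p ^ v * m\<close> are both four times the positive ones.\<close>
  have nonzero: "x \<noteq> 0 \<and> y \<noteq> 0" if "odd k" "\<And>s. k \<noteq> s ^ 2" "(x, y) \<in> form_reps (int D) (int k)" for k x y
  proof (intro conjI notI)
    assume "x = 0"
    then have "int k = int D * y ^ 2"
      using that by (simp add: form_reps_def)
    moreover have "even (int D)"
      using D by auto
    ultimately have "even (int k)"
      by simp
    with \<open>odd k\<close> show False
      by simp
  next
    assume "y = 0"
    then have "int k = int (nat \<bar>x\<bar> ^ 2)"
      using that by (simp add: form_reps_def)
    then show False
      using that(2) by (simp only: of_nat_eq_iff)
  qed
  have "4 * card (pos_form_reps D (p ^ v * m)) = (v + 1) * (4 * card (pos_form_reps D m))"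
    using * card_form_reps_eq_4_pos[of D m] card_form_reps_eq_4_pos[of D "p ^ v * m"]
      nonzero[OF m(2,3)] nonzero[of "p ^ v * m", OF _ n] p(2) m(2)
    by simp
  then have "card (pos_form_reps D (p ^ v * m)) = (v + 1) * card (pos_form_reps D m)"
    by simp
  with v show ?thesis
    by simp
next
  case False
  \<comment> \<open>If \<open>p\<close> did not divide \<open>y\<close>, Thue's lemma would
    represent \<open>p\<close> by the form, which this case excludes.\<close>
  have inert: "int p dvd y" if "int p dvd x ^ 2 + int D * y ^ 2" for x y
    using prime_eq_form_2_4[OF p _ that] False D by auto
  obtain k where k: "v = 2 * k + 1"
    using v by (elim oddE)
  have "form_reps (int D) (int p ^ v * int m) = {}"
    unfolding k by (rule form_reps_prime_power_mult_empty[OF _ _ inert]) (use p m in simp_all)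
  moreover have "(int x, int y) \<in> form_reps (int D) (int p ^ v * int m)"
    if "(x, y) \<in> pos_form_reps D (p ^ v * m)" for x y
    using that by (auto simp: pos_form_reps_def form_reps_def simp flip: of_nat_power of_nat_mult of_nat_add)
  ultimately have "pos_form_reps D (p ^ v * m) = {}"
    by auto
  then show ?thesis
    by simp
qed

section \<open>Parity of divisor counts\<close>

text \<open>The involution \<open>d \<mapsto> n div d\<close> fixes exactly the square root of
  \<open>n\<close>, if there is one.\<close>

lemma even_card_divisors_iff:
  fixes n :: nat
  assumes "n > 0"
  shows "even (card {d. d dvd n}) \<longleftrightarrow> (\<forall>s. n \<noteq> s ^ 2)"
proof -
  let ?F = "{d \<in> {d. d dvd n}. n div d = d}"
  have "even (card {d. d dvd n}) \<longleftrightarrow> even (card ?F)"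
    using assms by (intro even_card_involution) (auto elim!: dvdE)
  moreover have F: "d \<in> ?F \<longleftrightarrow> n = d ^ 2" for d
    using assms by (auto simp: power2_eq_square elim!: dvdE)
  moreover have "card ?F = (if \<forall>s. n \<noteq> s ^ 2 then 0 else 1)"
  proof (cases "\<forall>s. n \<noteq> s ^ 2")
    case True
    with F have "?F = {}" by blast
    then show ?thesis unfolding \<open>?F = {}\<close> using True by simp
  next
    case False
    then obtain s where s: "n = s ^ 2" by blast
    have "d \<in> ?F \<longleftrightarrow> d \<in> {s}" for d
      unfolding F by (auto simp: s)
    then have "?F = {s}"
      by blast
    then show ?thesis unfolding \<open>?F = {s}\<close> using False by simp
  qed
  ultimately show ?thesis
    by (simp split: if_splits)
qed

text \<open>For odd \<open>n\<close> this is the preceding lemma. Halving an even \<open>n\<close>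
  keeps the odd divisors and exchanges squares with doubles of squares.\<close>

lemma odd_card_odd_divisors_iff:
  fixes n :: nat
  assumes "n > 0"
  shows "odd (card {d. odd d \<and> d dvd n}) \<longleftrightarrow> (\<exists>y. n = y ^ 2 \<or> n = 2 * y ^ 2)"
  using assms
proof (induction n rule: less_induct)
  case (less n)
  show ?case
  proof (cases "even n")
    case False
    then have "{d. odd d \<and> d dvd n} = {d. d dvd n}" "n \<noteq> 2 * y ^ 2" for y
      by auto
    then show ?thesis
      using even_card_divisors_iff[OF less.prems] by auto
  next
    case True
    then obtain m where m: "n = 2 * m"
      by (elim evenE)
    have "{d. odd d \<and> d dvd n} = {d. odd d \<and> d dvd m}"
      by (auto simp: m coprime_dvd_mult_right_iff)
    moreover have "odd (card {d. odd d \<and> d dvd m}) \<longleftrightarrow> (\<exists>y. m = y ^ 2 \<or> m = 2 * y ^ 2)"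
      using less by (simp add: m)
    moreover have "(\<exists>y. m = y ^ 2 \<or> m = 2 * y ^ 2) \<longleftrightarrow> (\<exists>y. n = y ^ 2 \<or> n = 2 * y ^ 2)"
    proof
      assume "\<exists>y. m = y ^ 2 \<or> m = 2 * y ^ 2"
      then obtain y where "n = 2 * y ^ 2 \<or> n = (2 * y) ^ 2"
        unfolding m by (auto simp: power_mult_distrib)
      then show "\<exists>y. n = y ^ 2 \<or> n = 2 * y ^ 2"
        by blast
    next
      assume "\<exists>y. n = y ^ 2 \<or> n = 2 * y ^ 2"
      then obtain y where "n = y ^ 2 \<or> m = y ^ 2"
        unfolding m by auto
      then show "\<exists>y. m = y ^ 2 \<or> m = 2 * y ^ 2"
      proof
        assume y: "n = y ^ 2"
        with True have "even y"
          by simp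
        then obtain z where "y = 2 * z"
          by (elim evenE)
        with y m have "m = 2 * z ^ 2"
          by (simp add: power_mult_distrib)
        then show ?thesis by blast
      qed blast
    qed
    ultimately show ?thesis
      by (simp only:)
  qed
qed

text \<open>All divisors are odd, so their sum has the parity of their number.\<close>

lemma even_sum_divisors:
  fixes n :: nat
  assumes "odd n" "\<And>s. n \<noteq> s ^ 2"
  shows "even (\<Sum>{d. d dvd n})"
proof -
  have n: "n > 0"
    using assms(1) by (rule odd_pos)
  have "{d \<in> {d. d dvd n}. odd d} = {d. d dvd n}"
    using assms(1) by auto
  then show ?thesis
    using even_card_divisors_iff[OF n] assms(2) n by (simp add: even_sum_iff)
qed

text \<open>Every divisor of \<open>a * b\<close> splits uniquely as \<open>x * y\<close>, the
  factors being recovered as gcds with \<open>a\<close> and \<open>b\<close>. This lets two even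
  divisor sums combine to a multiple of 4.\<close>

lemma sum_divisors_mult_coprime:
  fixes a b :: nat
  assumes "coprime a b"
  shows "\<Sum>{d. d dvd a * b} = \<Sum>{d. d dvd a} * \<Sum>{d. d dvd b}"
proof -
  have "bij_betw (\<lambda>(x, y). x * y) ({d. d dvd a} \<times> {d. d dvd b}) {d. d dvd a * b}"
  proof (rule bij_betw_imageI)
    have gcd: "gcd (x * y) a = x \<and> gcd (x * y) b = y" if "x dvd a" "y dvd b" for x y
    proof -
      have "coprime a y" "coprime b x"
        using that assms by (meson coprime_commute coprime_divisors dvd_refl)+
      then show ?thesis
        using that by (simp add: gcd_mult_left_left_cancel gcd_mult_left_right_cancel gcd_nat.absorb1)
    qed
    show "inj_on (\<lambda>(x, y). x * y) ({d. d dvd a} \<times> {d. d dvd b})"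
      by (intro inj_onI, clarify) (metis gcd)
    show "(\<lambda>(x, y). x * y) ` ({d. d dvd a} \<times> {d. d dvd b}) = {d. d dvd a * b}"
      by (force dest!: division_decomp intro: mult_dvd_mono)
  qed
  from sum.reindex_bij_betw[OF this, of "\<lambda>d. d"]
  have "(\<Sum>d | d dvd a * b. d) = (\<Sum>(x, y)\<in>{d. d dvd a} \<times> {d. d dvd b}. x * y)"
    by (simp add: case_prod_beta')
  then show ?thesis
    by (simp add: sum_product sum.cartesian_product)
qed

section \<open>Pairs of odd divisors\<close>

text \<open>The condition \<open>d < e\<close> is dropped so that the exchanges of coordinates used
  below act on the set.\<close>

definition odd_quads :: "nat \<Rightarrow> (nat \<times> nat \<times> nat \<times> nat) set" where
  "odd_quads n = {(d, m, e, l). odd d \<and> odd e \<and> 0 < m \<and> 0 < l \<and> d * m + e * l = n}"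

lemma finite_odd_quads: "finite (odd_quads n)"
proof (rule finite_subset)
  show "odd_quads n \<subseteq> {..n} \<times> {..n} \<times> {..n} \<times> {..n}"
  proof clarify
    fix d m e l assume "(d, m, e, l) \<in> odd_quads n"
    then have *: "d * m + e * l = n" "0 < m" "0 < l" "0 < d" "0 < e"
      by (auto simp: odd_quads_def odd_pos)
    then have "d \<le> d * m" "m \<le> d * m" "e \<le> e * l" "l \<le> e * l"
      by auto
    with *(1) have "d \<le> n" "m \<le> n" "e \<le> n" "l \<le> n"
      by linarith+
    then show "d \<in> {..n} \<and> (m, e, l) \<in> {..n} \<times> {..n} \<times> {..n}"
      by auto
  qed
qed auto

text \<open>With \<open>d = e\<close> the equation reads \<open>d * (m + l) = n\<close>, which
  leaves \<open>n div d - 1\<close> choices of \<open>m\<close> for each divisor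
  \<open>d\<close>.\<close>

lemma card_odd_quads_diagonal:
  assumes "odd n"
  shows "card {(d, m, e, l) \<in> odd_quads n. d = e} + card {d. d dvd n} = \<Sum>{d. d dvd n}"
proof -
  have n: "n > 0"
    using assms by (rule odd_pos)
  have "bij_betw (\<lambda>(d, m). (d, m, d, n div d - m)) (SIGMA d:{d. d dvd n}. {1..<n div d})
      {(d, m, e, l) \<in> odd_quads n. d = e}"
  proof (rule bij_betw_byWitness[where f' = "\<lambda>(d, m, e, l). (d, m)"])
    show "(\<lambda>(d, m). (d, m, d, n div d - m)) ` (SIGMA d:{d. d dvd n}. {1..<n div d})
        \<subseteq> {(d, m, e, l) \<in> odd_quads n. d = e}"
      using assms by (auto simp: odd_quads_def simp flip: distrib_left)
    show "(\<lambda>(d, m, e, l). (d, m)) ` {(d, m, e, l) \<in> odd_quads n. d = e}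
        \<subseteq> (SIGMA d:{d. d dvd n}. {1..<n div d})"
      using n by (auto simp: odd_quads_def simp flip: distrib_left)
  qed (auto simp: odd_quads_def odd_pos simp flip: distrib_left)
  then have "card {(d, m, e, l) \<in> odd_quads n. d = e} = (\<Sum>d | d dvd n. n div d - 1)"
    using n by (subst bij_betw_same_card[symmetric]) auto
  moreover have "(\<Sum>d | d dvd n. n div d - 1) + card {d. d dvd n} = (\<Sum>d | d dvd n. n div d)"
  proof -
    have "(\<Sum>d | d dvd n. n div d - 1) + (\<Sum>d | d dvd n. 1) = (\<Sum>d | d dvd n. n div d)"
      unfolding sum.distrib[symmetric]
      by (rule sum.cong) (use n in \<open>auto simp: dvd_div_eq_0_iff Suc_le_eq intro!: le_add_diff_inverse2 elim!: dvdE\<close>)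
    then show ?thesis by simp
  qed
  moreover have "(\<Sum>d | d dvd n. n div d) = \<Sum>{d. d dvd n}"
    by (rule sum.reindex_bij_witness[where i = "\<lambda>d. n div d" and j = "\<lambda>d. n div d"])
      (use n in \<open>auto elim!: dvdE\<close>)
  ultimately show ?thesis
    by simp
qed

text \<open>Exchanging \<open>(d, m)\<close> with \<open>(e, l)\<close> matches \<open>d < e\<close>
  with \<open>e < d\<close>; the diagonal contributes the divisor sum minus the divisor
  count.\<close>

lemma card_odd_quads:
  assumes "odd n"
  shows "2 * card {(d, m, e, l) \<in> odd_quads n. d < e} + \<Sum>{d. d dvd n} =
    card (odd_quads n) + card {d. d dvd n}"
proof -
  let ?L = "{(d, m, e, l) \<in> odd_quads n. d < e}"
  let ?G = "{(d, m, e, l) \<in> odd_quads n. e < d}"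
  let ?E = "{(d, m, e, l) \<in> odd_quads n. d = e}"
  have fin: "finite ?L" "finite ?G" "finite ?E"
    by (rule finite_subset[OF _ finite_odd_quads[of n]], blast)+
  have "bij_betw (\<lambda>(d, m, e, l). (e, l, d, m)) ?L ?G"
    by (rule bij_betw_byWitness[where f' = "\<lambda>(d, m, e, l). (e, l, d, m)"])
      (auto simp: odd_quads_def add.commute)
  then have "card ?L = card ?G"
    by (rule bij_betw_same_card)
  moreover have "odd_quads n = ?L \<union> ?G \<union> ?E"
    by auto
  then have "card (odd_quads n) = card (?L \<union> ?G \<union> ?E)"
    by (rule arg_cong)
  moreover have "card (?L \<union> ?G \<union> ?E) = card ?L + card ?G + card ?E"
    using fin by (subst card_Un_disjoint, auto)+
  ultimately show ?thesis
    using card_odd_quads_diagonal[OF assms] by simp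
qed

text \<open>Irrationality of sqrt(2) by descent; it later keeps the two families of fixed points
  apart.\<close>

lemma square_neq_twice_square:
  fixes y z :: nat
  shows "y ^ 2 = 2 * z ^ 2 \<Longrightarrow> y = 0"
proof (induction y arbitrary: z rule: less_induct)
  case (less y)
  then have "even (y ^ 2)"
    by simp
  then obtain w where w: "y = 2 * w"
    by auto
  with less.prems have zw: "z ^ 2 = 2 * w ^ 2"
    by (simp add: power_mult_distrib)
  show ?case
  proof (rule ccontr)
    assume "y \<noteq> 0"
    then have "z ^ 2 < y ^ 2"
      using less.prems by (cases "z = 0") auto
    then have "z < y"
      by (rule power_less_imp_less_base) simp
    then have "z = 0"
      using less.IH zw by blast
    with less.prems \<open>y \<noteq> 0\<close> show False
      by simp
  qed
qed

text \<open>As \<open>d\<close>, \<open>e\<close> and \<open>n\<close> are odd, exactly one of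
  \<open>m\<close> and \<open>l\<close> is odd, and the exchange of the two pairs swaps these
  cases.\<close>

lemma card_odd_quads_eq_double:
  assumes "odd n"
  shows "card (odd_quads n) = 2 * card {(d, m, e, l) \<in> odd_quads n. odd m}"
proof -
  let ?O = "{(d, m, e, l) \<in> odd_quads n. odd m}"
  let ?E = "{(d, m, e, l) \<in> odd_quads n. even m}"
  have parity: "odd m \<longleftrightarrow> even l" if "(d, m, e, l) \<in> odd_quads n" for d m e l
  proof -
    have "odd d" "odd e" "odd (d * m + e * l)"
      using that assms by (auto simp: odd_quads_def)
    then show ?thesis
      by simp
  qed
  have swap: "(e, l, d, m) \<in> odd_quads n" if "(d, m, e, l) \<in> odd_quads n" for d m e l
    using that by (auto simp: odd_quads_def add.commute)
  have "bij_betw (\<lambda>(d, m, e, l). (e, l, d, m)) ?O ?E"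
    by (rule bij_betw_byWitness[where f' = "\<lambda>(d, m, e, l). (e, l, d, m)"])
      (use parity swap in auto)
  then have "card ?O = card ?E"
    by (rule bij_betw_same_card)
  moreover have "finite ?O" "finite ?E"
    by (rule finite_subset[OF _ finite_odd_quads[of n]], blast)+
  then have "card (?O \<union> ?E) = card ?O + card ?E"
    by (rule card_Un_disjoint) auto
  moreover have "?O \<union> ?E = odd_quads n"
    by auto
  ultimately show ?thesis
    by simp
qed

section \<open>From quadruples to the two quadratic forms\<close>

text \<open>The first coordinate determines the second. Since \<open>n\<close> and \<open>d\<close>
  are odd, the root of \<open>n - d ^ 2\<close> is even, which accounts for the coefficient
  4.\<close>

lemma card_pos_form_reps_4:
  assumes "odd n"
  shows "card (pos_form_reps 4 n) = card {d. odd d \<and> d ^ 2 < n \<and> (\<exists>y. n - d ^ 2 = y ^ 2)}"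
proof (rule bij_betw_same_card[of fst], rule bij_betw_imageI)
  show "inj_on fst (pos_form_reps 4 n)"
    by (auto simp: inj_on_def pos_form_reps_def)
  show "fst ` pos_form_reps 4 n = {d. odd d \<and> d ^ 2 < n \<and> (\<exists>y. n - d ^ 2 = y ^ 2)}"
  proof (intro equalityI subsetI)
    fix d assume "d \<in> fst ` pos_form_reps 4 n"
    then obtain y where y: "0 < y" "d ^ 2 + 4 * y ^ 2 = n"
      by (auto simp: pos_form_reps_def)
    then have "n - d ^ 2 = (2 * y) ^ 2" "d ^ 2 < n" "odd (d ^ 2 + 4 * y ^ 2)"
      using assms by (auto simp: power_mult_distrib)
    then show "d \<in> {d. odd d \<and> d ^ 2 < n \<and> (\<exists>y. n - d ^ 2 = y ^ 2)}"
      by (intro CollectI conjI exI[of _ "2 * y"]) simp_all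
  next
    fix d assume "d \<in> {d. odd d \<and> d ^ 2 < n \<and> (\<exists>y. n - d ^ 2 = y ^ 2)}"
    then obtain y where y: "odd d" "d ^ 2 < n" "n - d ^ 2 = y ^ 2"
      by blast
    then have n: "n = d ^ 2 + y ^ 2"
      by linarith
    then have "even y"
      using assms y(1) by simp
    then obtain z where z: "y = 2 * z"
      by (elim evenE)
    have "(d, z) \<in> pos_form_reps 4 n"
      using y n by (auto simp: pos_form_reps_def z power_mult_distrib odd_pos)
    then show "d \<in> fst ` pos_form_reps 4 n"
      by force
  qed
qed

lemma card_pos_form_reps_2:
  assumes "odd n"
  shows "card (pos_form_reps 2 n) = card {d. odd d \<and> d ^ 2 < n \<and> (\<exists>y. n - d ^ 2 = 2 * y ^ 2)}"
proof (rule bij_betw_same_card[of fst], rule bij_betw_imageI)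
  show "inj_on fst (pos_form_reps 2 n)"
    by (auto simp: inj_on_def pos_form_reps_def)
  show "fst ` pos_form_reps 2 n = {d. odd d \<and> d ^ 2 < n \<and> (\<exists>y. n - d ^ 2 = 2 * y ^ 2)}"
  proof (intro equalityI subsetI)
    fix d assume "d \<in> fst ` pos_form_reps 2 n"
    then obtain y where y: "0 < y" "d ^ 2 + 2 * y ^ 2 = n"
      by (auto simp: pos_form_reps_def)
    then have "n - d ^ 2 = 2 * y ^ 2" "d ^ 2 < n" "odd (d ^ 2 + 2 * y ^ 2)"
      using assms by auto
    then show "d \<in> {d. odd d \<and> d ^ 2 < n \<and> (\<exists>y. n - d ^ 2 = 2 * y ^ 2)}"
      by auto
  next
    fix d assume "d \<in> {d. odd d \<and> d ^ 2 < n \<and> (\<exists>y. n - d ^ 2 = 2 * y ^ 2)}"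
    then obtain y where y: "odd d" "d ^ 2 < n" "n - d ^ 2 = 2 * y ^ 2"
      by blast
    then have "(d, y) \<in> pos_form_reps 2 n"
      by (auto simp: pos_form_reps_def odd_pos intro!: gr0I)
    then show "d \<in> fst ` pos_form_reps 2 n"
      by force
  qed
qed

text \<open>Exchanging the odd numbers \<open>d\<close> and \<open>m\<close> leaves the fixed points
  \<open>n = d ^ 2 + e * l\<close>. For given \<open>d\<close> they correspond to the odd divisors
  \<open>e\<close> of \<open>n - d ^ 2\<close>, whose number is odd just when
  \<open>n - d ^ 2\<close> is a square or twice a square.\<close>

lemma even_card_odd_quads_odd_iff:
  assumes "odd n"
  shows "even (card {(d, m, e, l) \<in> odd_quads n. odd m}) \<longleftrightarrow>
    even (card (pos_form_reps 4 n) + card (pos_form_reps 2 n))"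
proof -
  let ?O = "{(d, m, e, l) \<in> odd_quads n. odd m}"
  let ?f = "\<lambda>(d, m, e, l). (m, d, e, l)"
  \<comment> \<open>The strict bound makes the subtraction in \<open>?E\<close> exact and the
    cofactor \<open>l\<close> positive.\<close>
  let ?D = "{d. odd d \<and> d ^ 2 < n}"
  let ?E = "\<lambda>d. {e. odd e \<and> e dvd n - d ^ 2}"
  have finD: "finite ?D"
  proof (rule finite_subset)
    have "d \<le> n" if "d ^ 2 < n" for d
      using that self_le_power[of d 2] by (cases "d = 0") auto
    then show "?D \<subseteq> {..n}"
      by auto
  qed auto
  have finE: "finite (?E d)" if "d \<in> ?D" for d
    using that by (intro finite_subset[OF _ finite_divisors_nat[of "n - d ^ 2"]]) auto
  have "even (card ?O) \<longleftrightarrow> even (card {x \<in> ?O. ?f x = x})"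
  proof (rule even_card_involution)
    show "finite ?O"
      by (rule finite_subset[OF _ finite_odd_quads[of n]]) blast
    show "?f x \<in> ?O \<and> ?f (?f x) = x" if "x \<in> ?O" for x
      using that by (auto simp: odd_quads_def mult.commute odd_pos)
  qed
  also have "card {x \<in> ?O. ?f x = x} = card (Sigma ?D ?E)"
  proof (rule bij_betw_same_card)
    show "bij_betw (\<lambda>(d, m, e, l). (d, e)) {x \<in> ?O. ?f x = x} (Sigma ?D ?E)"
    proof (rule bij_betw_byWitness[where f' = "\<lambda>(d, e). (d, d, e, (n - d ^ 2) div e)"])
      show "(\<lambda>(d, e). (d, d, e, (n - d ^ 2) div e)) ` Sigma ?D ?E \<subseteq> {x \<in> ?O. ?f x = x}"
      proof (rule image_subsetI, unfold split_paired_all)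
        fix d e assume "(d, e) \<in> Sigma ?D ?E"
        then have *: "odd d" "d ^ 2 < n" "odd e" "e dvd n - d ^ 2"
          by auto
        then have "e * ((n - d ^ 2) div e) = n - d ^ 2"
          by simp
        with * have "d * d + e * ((n - d ^ 2) div e) = n" "0 < (n - d ^ 2) div e" "0 < d"
          by (auto simp: power2_eq_square odd_pos intro!: gr0I)
        with * show "(case (d, e) of (d, e) \<Rightarrow> (d, d, e, (n - d ^ 2) div e)) \<in> {x \<in> ?O. ?f x = x}"
          by (simp add: odd_quads_def)
      qed
      have quad: "d = m \<and> odd d \<and> odd e \<and> d ^ 2 < n \<and> n - d ^ 2 = e * l \<and> 0 < e"
        if "(d, m, e, l) \<in> {x \<in> ?O. ?f x = x}" for d m e l
      proof -
        have "?f (d, m, e, l) = (d, m, e, l)" and quad: "(d, m, e, l) \<in> odd_quads n"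
          using that by blast+
        then have "d = m"
          unfolding prod.case prod.inject by (elim conjE)
        with quad have *: "d = m" "odd d" "odd e" "0 < l" "d * m + e * l = n"
          by (simp_all add: odd_quads_def)
        have "0 < e * l"
          using *(3,4) by (simp add: odd_pos)
        moreover have "d ^ 2 + e * l = n"
          using *(1,5) by (simp add: power2_eq_square)
        ultimately have "d ^ 2 < n" "n - d ^ 2 = e * l"
          by linarith+
        with * show ?thesis
          by (simp add: odd_pos)
      qed
      show "(\<lambda>(d, m, e, l). (d, e)) ` {x \<in> ?O. ?f x = x} \<subseteq> Sigma ?D ?E"
      proof (rule image_subsetI, unfold split_paired_all)
        fix d m e l assume "(d, m, e, l) \<in> {x \<in> ?O. ?f x = x}"
        from quad[OF this] show "(case (d, m, e, l) of (d, m, e, l) \<Rightarrow> (d, e)) \<in> Sigma ?D ?E"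
          by auto
      qed
      show "\<forall>x\<in>{x \<in> ?O. ?f x = x}. (\<lambda>(d, e). (d, d, e, (n - d ^ 2) div e)) ((\<lambda>(d, m, e, l). (d, e)) x) = x"
      proof (rule ballI, unfold split_paired_all)
        fix d m e l assume "(d, m, e, l) \<in> {x \<in> ?O. ?f x = x}"
        from quad[OF this] show "(case case (d, m, e, l) of (d, m, e, l) \<Rightarrow> (d, e) of
            (d, e) \<Rightarrow> (d, d, e, (n - d ^ 2) div e)) = (d, m, e, l)"
          by auto
      qed
    qed auto
  qed
  also have "card (Sigma ?D ?E) = (\<Sum>d\<in>?D. card (?E d))"
    by (rule card_SigmaI[OF finD]) (rule ballI, rule finE)
  also have "even (\<Sum>d\<in>?D. card (?E d)) \<longleftrightarrow> even (card {d \<in> ?D. odd (card (?E d))})"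
    using finD by (rule even_sum_iff)
  also have "{d \<in> ?D. odd (card (?E d))} =
      {d. odd d \<and> d ^ 2 < n \<and> (\<exists>y. n - d ^ 2 = y ^ 2)} \<union> {d. odd d \<and> d ^ 2 < n \<and> (\<exists>y. n - d ^ 2 = 2 * y ^ 2)}"
    (is "_ = ?A \<union> ?B")
  proof -
    have "odd (card (?E d)) \<longleftrightarrow> (\<exists>y. n - d ^ 2 = y ^ 2) \<or> (\<exists>y. n - d ^ 2 = 2 * y ^ 2)" if "d ^ 2 < n" for d
      using odd_card_odd_divisors_iff[of "n - d ^ 2"] that by (simp add: ex_disj_distrib)
    then show ?thesis
      by blast
  qed
  also have "card (?A \<union> ?B) = card ?A + card ?B"
  proof (rule card_Un_disjoint)
    show "finite ?A" "finite ?B"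
      by (rule finite_subset[OF _ finD], blast)+
    show "?A \<inter> ?B = {}"
    proof -
      have False if "d ^ 2 < n" "n - d ^ 2 = y ^ 2" "n - d ^ 2 = 2 * z ^ 2" for d y z
        using that square_neq_twice_square[of y z] by auto
      then show ?thesis
        by blast
    qed
  qed
  finally show ?thesis
    by (simp only: card_pos_form_reps_4[OF assms] card_pos_form_reps_2[OF assms])
qed

section \<open>The congruence\<close>

text \<open>The multiplicity of \<open>p\<close> is the odd number \<open>v\<close> on the left and
  even on the right.\<close>

lemma prime_power_mult_not_square:
  fixes p m :: nat
  assumes "prime p" "odd v" "\<not> p dvd m"
  shows "p ^ v * m \<noteq> s ^ 2"
proof
  assume eq: "p ^ v * m = s ^ 2"
  have "m \<noteq> 0" "p \<noteq> 0"
    using assms(1,3) by (metis dvd_0_right, metis not_prime_0)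
  then have "s \<noteq> 0"
    using eq by (cases "s = 0") auto
  have "multiplicity p (p ^ v * m) = v"
    using assms \<open>m \<noteq> 0\<close> by (intro multiplicity_eqI) auto
  moreover have "multiplicity p (s ^ 2) = 2 * multiplicity p s"
    using assms \<open>s \<noteq> 0\<close> by (simp add: prime_elem_multiplicity_power_distrib)
  ultimately show False
    using assms(2) eq by (metis dvd_triv_left)
qed

text \<open>The arithmetic core: the condition modulo 8 on the primes of the theorem enters only
  through the nonsquareness of \<open>m\<close>.\<close>

lemma OPT_3_prime_power_mult:
  fixes p m v :: nat
  assumes p: "prime p" "odd p" and v: "odd v" and m: "\<not> p dvd m" "odd m" "\<And>s. m \<noteq> s ^ 2"
  shows "[OPT 3 (int (p ^ v * m)) = 0] (mod 8)"
proof -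
  define n where "n = p ^ v * m"
  have n: "odd n" "n > 0"
    using p m by (auto simp: n_def odd_pos)
  have n_sq: "n \<noteq> s ^ 2" for s
    unfolding n_def using p(1) v m(1) by (rule prime_power_mult_not_square)
  have forms: "even (card (pos_form_reps D n))" if "D \<in> {2, 4}" for D
    unfolding n_def using p v m n_sq[unfolded n_def] that by (rule even_card_pos_form_reps)
  have odd_div: "{d. odd d \<and> d dvd n} = {d. d dvd n}"
    using n by auto
  have "even (card {(d, m, e, l) \<in> odd_quads n. odd m})"
    unfolding even_card_odd_quads_odd_iff[OF n(1)] using forms by simp
  then obtain q where q: "card (odd_quads n) = 4 * q"
    using card_odd_quads_eq_double[OF n(1)] by (auto elim!: evenE)
  obtain t where t: "card {d. d dvd n} = 2 * t"
    using even_card_divisors_iff[OF n(2)] n_sq by (metis evenE)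
  \<comment> \<open>Neither \<open>p ^ v\<close> nor \<open>m\<close> is a square, so both divisor
    sums are even and their product is divisible by 4.\<close>
  have "coprime (p ^ v) m"
    using p(1) m(1) by (simp add: prime_imp_coprime)
  moreover have "p ^ v \<noteq> s ^ 2" for s
    using prime_power_mult_not_square[OF p(1) v, where m = 1 and s = s] p(1) not_prime_1 by fastforce
  then have "even (\<Sum>{d. d dvd p ^ v})"
    using p(2) by (intro even_sum_divisors) simp_all
  moreover have "even (\<Sum>{d. d dvd m})"
    using m by (intro even_sum_divisors)
  ultimately obtain s where s: "\<Sum>{d. d dvd n} = 4 * s"
    unfolding n_def by (auto simp: sum_divisors_mult_coprime elim!: evenE)
  have T: "{(d, m, e, l). odd d \<and> odd e \<and> 0 < m \<and> 0 < l \<and> d * m + e * l = n \<and> d < e} =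
      {(d, m, e, l) \<in> odd_quads n. d < e}"
    by (auto simp: odd_quads_def)
  have "8 dvd card (odd_overparts n)"
  proof -
    let ?T = "card {(d, m, e, l) \<in> odd_quads n. d < e}"
    have "2 * ?T + 4 * s = 4 * q + 2 * t"
      using card_odd_quads[OF n(1)] unfolding q t s .
    \<comment> \<open>Doubling the relation and adding \<open>4 * t\<close> produces the expression
      of \<open>card_odd_overparts_cong\<close>, which is thus
      \<open>8 * (q + t - s)\<close>.\<close>
    then have "2 * (2 * t) + 4 * ?T + 8 * s = 8 * (q + t)"
      by simp
    then have "8 dvd 2 * (2 * t) + 4 * ?T"
      by presburger
    moreover have "[card (odd_overparts n) = 2 * (2 * t) + 4 * ?T] (mod 8)"
      using card_odd_overparts_cong[OF n(2)] unfolding odd_div T t .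
    ultimately show ?thesis
      by (simp add: cong_dvd_iff)
  qed
  then have "8 dvd 3 * int (card (odd_overparts n))"
    by (intro dvd_mult) presburger
  then have "8 dvd int (OPT 3 (int n))"
    using OPT_3_cong[OF n(1)] by (simp add: cong_dvd_iff)
  then have "8 dvd OPT 3 (int n)"
    by presburger
  then show ?thesis
    by (simp add: n_def cong_0_iff)
qed

lemma odd_square_cong_1_mod_8:
  fixes x :: int
  assumes "odd x"
  shows "[x ^ 2 = 1] (mod 8)"
proof -
  obtain y where y: "x = 2 * y + 1"
    using assms by (elim oddE)
  have "even (y * (y + 1))"
    by simp
  then obtain c where c: "y * (y + 1) = 2 * c"
    by (elim evenE)
  have "x ^ 2 - 1 = 4 * (y * (y + 1))"
    by (simp add: y power2_eq_square algebra_simps)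
  then show ?thesis
    by (simp add: c cong_iff_dvd_diff)
qed

theorem theorem1p7:
  fixes k n :: nat and p :: "nat \<Rightarrow> nat" and j :: int
  assumes "\<And>i. 1 \<le> i \<Longrightarrow> i \<le> k + 1 \<Longrightarrow> prime (p i) \<and> p i \<ge> 3 \<and> \<not> [p i = 1] (mod 8)"
    and "\<not> [j = 0] (mod int (p (k + 1)))"
  shows "[OPT 3 (8 * (\<Prod>i=1..k+1. (int (p i))\<^sup>2) * int n
                 + (\<Prod>i=1..k. (int (p i))\<^sup>2) * int (p (k + 1)) * (8 * j + int (p (k + 1)))) = 0] (mod 8)"
proof -
  define P where "P = p (k + 1)"
  define L where "L = (\<Prod>i=1..k. int (p i))"
  \<comment> \<open>The cofactor left after taking \<open>L ^ 2 * int P\<close> out of both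
    summands; it is congruent to \<open>P\<close> modulo 8 and, like \<open>8 * j\<close>, not
    divisible by \<open>P\<close>.\<close>
  define c where "c = 8 * (int P * int n + j) + int P"
  define N where "N = L ^ 2 * int P * c"
  have N: "8 * (\<Prod>i=1..k+1. (int (p i))\<^sup>2) * int n
      + (\<Prod>i=1..k. (int (p i))\<^sup>2) * int (p (k + 1)) * (8 * j + int (p (k + 1))) = N"
  proof -
    have L2: "(\<Prod>i=1..k. (int (p i))\<^sup>2) = L ^ 2"
      by (simp add: L_def prod_power_distrib)
    have "(\<Prod>i=1..k+1. (int (p i))\<^sup>2) = L ^ 2 * int P ^ 2"
      unfolding L2[symmetric] by (simp add: P_def)
    then show ?thesis
      unfolding L2 P_def[symmetric] by (simp add: N_def c_def algebra_simps power2_eq_square)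
  qed
  have odd_p: "odd (p i)" if "i \<in> {1..k+1}" for i
    using assms(1)[of i] that primes_dvd_imp_eq[OF two_is_prime_nat, of "p i"] by auto
  have P: "prime P" "odd P" "\<not> [P = 1] (mod 8)"
    using assms(1)[of "k + 1"] odd_p[of "k + 1"] by (auto simp: P_def)
  have L: "odd L"
    using odd_p by (auto simp: L_def even_prod_iff)
  have c: "odd c" "\<not> int P dvd c"
  proof -
    show "odd c"
      using P by (simp add: c_def)
    have "\<not> int P dvd j"
      using assms(2) by (simp add: P_def cong_0_iff)
    moreover have "\<not> int P dvd 8"
    proof
      assume "int P dvd 8"
      then have "int P dvd 2 ^ 3"
        by simp
      then have "int P dvd 2"
        using P(1) by (metis prime_dvd_power prime_nat_int_transfer)
      with odd_prime_not_dvd_2[OF P(1,2)] show False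
        by simp
    qed
    ultimately have "\<not> int P dvd 8 * j"
      using P(1) by (simp add: prime_dvd_mult_iff)
    moreover have "c = 8 * j + int P * (8 * int n + 1)"
      by (simp add: c_def algebra_simps)
    ultimately show "\<not> int P dvd c"
      by (metis dvd_add_left_iff dvd_triv_left)
  qed
  show ?thesis
  \<comment> \<open>A negative \<open>j\<close> can make the argument negative, where
    \<open>OPT\<close> is 0.\<close>
  proof (cases "N < 0")
    case True
    then show ?thesis
      unfolding N by (simp add: OPT_negative)
  next
    case False
    define L' where "L' = nat \<bar>L\<bar>"
    define c' where "c' = nat c"
    have "int P * L ^ 2 > 0"
      using P L by (auto simp: prime_gt_0_nat zero_less_mult_iff)
    with False c have c': "int c' = c"
      by (auto simp: c'_def N_def mult_less_0_iff algebra_simps)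
    have "L' \<noteq> 0"
      using L by (auto simp: L'_def)
    \<comment> \<open>The prime \<open>P\<close> may recur among the other primes, so its full power
      is split off from \<open>L'\<close>. Squaring that power and adding the single factor
      \<open>P\<close> gives the odd exponent \<open>v\<close>.\<close>
    then obtain r where r: "L' = P ^ multiplicity P L' * r" "\<not> P dvd r"
      using multiplicity_decompose'[of L' P] P(1) by (metis not_prime_unit)
    define v where "v = 2 * multiplicity P L' + 1"
    define m where "m = r ^ 2 * c'"
    have "N = int (L' ^ 2 * P * c')"
      by (simp add: N_def c' L'_def)
    also have "L' ^ 2 * P * c' = P ^ v * m"
      by (subst r) (simp add: v_def m_def power_mult_distrib power_mult algebra_simps)
    finally have n: "N = int (P ^ v * m)" .
    have "odd r"
    proof
      assume "even r"
      then have "even L'"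
        by (subst r) simp
      with L show False
        by (simp add: L'_def even_nat_iff)
    qed
    have odd_m: "odd m"
      using \<open>odd r\<close> c(1) c' by (auto simp: m_def simp flip: even_of_nat_iff[of c'])
    have not_dvd_m: "\<not> P dvd m"
      using P(1) r(2) c(2) unfolding c'[symmetric]
      by (simp add: m_def prime_dvd_mult_iff prime_dvd_power_iff)
    \<comment> \<open>Since \<open>r ^ 2\<close> is 1 modulo 8, \<open>m\<close> is congruent to
      \<open>P\<close>, which is not 1; but an odd square is 1 modulo 8.\<close>
    have "[c = int P] (mod 8)"
      by (simp add: c_def cong_iff_dvd_diff)
    then have "[int r ^ 2 * c = 1 * int P] (mod 8)"
      using \<open>odd r\<close> by (intro cong_mult odd_square_cong_1_mod_8) simp_all
    then have m_cong: "[int m = int P] (mod 8)"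
      by (simp add: m_def c')
    have "m \<noteq> s ^ 2" for s
    proof
      assume "m = s ^ 2"
      with odd_m m_cong odd_square_cong_1_mod_8[of "int s"] have "[int P = int 1] (mod int 8)"
        by (auto simp: cong_def)
      with P(3) show False
        by (simp only: cong_int_iff)
    qed
    then have "[OPT 3 (int (P ^ v * m)) = 0] (mod 8)"
      using P not_dvd_m odd_m by (intro OPT_3_prime_power_mult) (auto simp: v_def)
    then show ?thesis
      unfolding N n .
  qed
qed

end
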